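(* For every $n\geq 2$, all complex zeros of the polynomial $Q_n^{(3)}(z)$ lie on the segment of the circle with radius $\frac{7}{8}$ and centered at $z=\frac{3}{8}$ that satisfies $\mathrm{Re}(z)<\frac{1}{2}$.
   Context: Let $Z=(w,x,y,z)$ be a quadruple of variables. The polynomials $S(n;Z)$, $n\ge 0$, are defined by the generating function $$\sum_{n=0}^{\infty}S(n;Z)q^n = \prod_{j=0}^{\infty}\left(1+wq^{3^j}\right)\left(1+xq^{3^j}\right)\left(1+yq^{3^j}+zq^{2\cdot 3^j}\right).$$ Define $Q_n(Z):=S(\tfrac{3^n-3}{2};Z)$ for $n\geq 1$, and $Q_n^{(3)}(z):=Q_n(1,1,z,z)$. *)

theory Defs
  imports "HOL-Analysis.Analysis" "HOL-Computational_Algebra.Formal_Power_Series"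
    "HOL-Computational_Algebra.Polynomial"
begin

(* The variables w, x, y, z range over an arbitrary integral domain, so that indeterminates
   (elements of a polynomial ring) as well as numbers may be substituted for them. *)
definition S_factor :: "'a::idom \<Rightarrow> 'a \<Rightarrow> 'a \<Rightarrow> 'a \<Rightarrow> nat \<Rightarrow> 'a fps" where
  "S_factor w x y z j =
     (1 + fps_const w * fps_X ^ (3 ^ j)) *
     (1 + fps_const x * fps_X ^ (3 ^ j)) *
     (1 + fps_const y * fps_X ^ (3 ^ j) + fps_const z * fps_X ^ (2 * 3 ^ j))"

(* The infinite product is taken in the X-adic topology of formal power series; it converges
   by S_factor_has_prod below. *)
definition S_poly :: "nat \<Rightarrow> 'a::idom \<Rightarrow> 'a \<Rightarrow> 'a \<Rightarrow> 'a \<Rightarrow> 'a" where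
  "S_poly n w x y z = fps_nth (\<Prod>j. S_factor w x y z j) n"

(* The division is exact for n \<ge> 1. *)
definition Q_poly :: "nat \<Rightarrow> 'a::idom \<Rightarrow> 'a \<Rightarrow> 'a \<Rightarrow> 'a \<Rightarrow> 'a" where
  "Q_poly n w x y z = S_poly ((3 ^ n - 3) div 2) w x y z"

(* [:0, 1:] is the indeterminate z. *)
definition Q3_poly :: "nat \<Rightarrow> complex poly" where
  "Q3_poly n = Q_poly n 1 1 [:0, 1:] [:0, 1:]"

lemma S_factor_prod_nth_stable:
  fixes w x y z :: "'a::idom"
  assumes "k < n"
  shows "fps_nth (\<Prod>j<n. S_factor w x y z j) k = fps_nth (\<Prod>j<Suc k. S_factor w x y z j) k"
  using assms
proof (induction n)
  case 0
  then show ?case by simp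
next
  case (Suc n)
  show ?case
  proof (cases "k = n")
    case True
    then show ?thesis by simp
  next
    case False
    then have kn: "k < n" using Suc.prems by simp
    define A where "A = (\<Prod>j<n. S_factor w x y z j)"
    define X where "X = (fps_X :: 'a fps) ^ (3 ^ n)"
    define G where "G = fps_const w + (fps_const x + fps_const w * fps_const x * X) +
       (fps_const y + fps_const z * X) * (1 + fps_const w * X) * (1 + fps_const x * X)"
    have X2: "(fps_X :: 'a fps) ^ (2 * 3 ^ n) = X * X"
      by (simp add: X_def mult_2 power_add)
    have "S_factor w x y z n = 1 + X * G"
      unfolding S_factor_def X2 G_def X_def[symmetric] by (simp add: algebra_simps)
    then have "(\<Prod>j<Suc n. S_factor w x y z j) = A + X * (A * G)"
      by (simp add: A_def algebra_simps)
    moreover have "k < 3 ^ n"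
      using kn power_gt_expt[of 3 n] by simp
    ultimately have "fps_nth (\<Prod>j<Suc n. S_factor w x y z j) k = fps_nth A k"
      by (simp add: X_def fps_X_power_mult_nth)
    then show ?thesis using Suc.IH[OF kn] by (simp add: A_def)
  qed
qed

lemma S_factor_has_prod:
  fixes w x y z :: "'a::idom"
  shows "S_factor w x y z has_prod Abs_fps (\<lambda>n. S_poly n w x y z)"
proof -
  define F where "F = Abs_fps (\<lambda>k. fps_nth (\<Prod>j<Suc k. S_factor w x y z j) k)"
  have "(\<lambda>n. \<Prod>i\<le>n. S_factor w x y z i) \<longlonglongrightarrow> F"
  proof (rule tendsto_fpsI)
    fix k
    have "fps_nth (\<Prod>i\<le>n. S_factor w x y z i) k = fps_nth F k" if "n \<ge> k" for n
      using S_factor_prod_nth_stable[of k "Suc n" w x y z] that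
      by (simp add: F_def lessThan_Suc_atMost)
    then show "\<forall>\<^sub>F n in sequentially. fps_nth (\<Prod>i\<le>n. S_factor w x y z i) k = fps_nth F k"
      by (auto simp: eventually_sequentially)
  qed
  moreover have "fps_nth F 0 = 1"
    by (simp add: F_def S_factor_def)
  then have "F \<noteq> 0" by auto
  ultimately have hp: "S_factor w x y z has_prod F"
    by (simp add: has_prod_def raw_has_prod_def)
  then have "(\<Prod>j. S_factor w x y z j) = F"
    using has_prod_unique by metis
  then have "Abs_fps (\<lambda>n. S_poly n w x y z) = F"
    by (simp add: S_poly_def fps_eq_iff)
  then show ?thesis using hp by simp
qed

end

theory Submission
  imports Defs
begin

text \<open>
  The first factor of the product defining \<open>S_poly\<close> is a polynomial of degree four in \<open>q\<close>, and the
  remaining factors form the whole product at \<open>q^3\<close>. Splitting off the first factor expresses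
  \<open>S (3 m + 3)\<close> and \<open>S (3 m + 4)\<close> linearly in \<open>S m\<close> and \<open>S (m + 1)\<close>. Since
  \<open>(3^(n+1) - 3) / 2 = 3 m + 3\<close> for \<open>m = (3^n - 3) / 2\<close>, the pairs \<open>(S m, S (m + 1))\<close> along these
  indices are the iterates of one \<open>2 \<times> 2\<close> matrix, so by Cayley--Hamilton \<open>Q_poly\<close> satisfies a
  second-order recurrence: it is the Lucas sequence attached to the trace \<open>t\<close> and the
  determinant \<open>d\<close> of that matrix.

  A Lucas sequence \<open>(\<alpha>^n - \<beta>^n) / (\<alpha> - \<beta>)\<close>, with \<open>\<alpha> + \<beta> = t\<close> and \<open>\<alpha> * \<beta> = d\<close>, vanishes only
  if \<open>\<alpha> / \<beta>\<close> is a root of unity other than \<open>1\<close> (or \<open>t = d = 0\<close>), and in either case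
  \<open>t^2 = 4 s d\<close> for a real \<open>s\<close> with \<open>0 \<le> s < 1\<close>. For \<open>w = x = 1\<close> and \<open>y = z\<close> one has \<open>t = 4 z + 2\<close> and \<open>d = 3 z^2 + 5 z\<close>,
  so that every zero satisfies the real quadratic equation \<open>(4 - 3 s) z^2 + (4 - 5 s) z + 1 = 0\<close>.
  Its discriminant \<open>s (25 s - 28)\<close> is not positive, hence
  \<open>\<bar>z\<bar>^2 = 1 / (4 - 3 s)\<close> and \<open>Re z = (5 s - 4) / (8 - 6 s)\<close>. Eliminating \<open>s\<close> gives
  the circle, and \<open>s < 1\<close> gives the bound on the real part.
\<close>

section \<open>Recurrences for the coefficients\<close>

text \<open>A coefficient of the infinite product is determined by finitely many factors. This
  reduces the functional equation of the product to an identity between finite products.\<close>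

lemma S_poly_eq_finite_prod:
  fixes w x y z :: "'a::idom"
  assumes "n < N"
  shows "S_poly n w x y z = fps_nth (\<Prod>j<N. S_factor w x y z j) n"
proof -
  \<comment> \<open>A nonvanishing constant term rules out the clause of \<open>has_prod\<close> for products with a zero factor.\<close>
  have "fps_nth (S_factor w x y z i) 0 = 1" for i
    by (simp add: S_factor_def)
  then have "S_factor w x y z i \<noteq> 0" for i
    by (metis fps_zero_nth zero_neq_one)
  then have "(\<lambda>k. \<Prod>i\<le>k. S_factor w x y z i) \<longlonglongrightarrow> Abs_fps (\<lambda>n. S_poly n w x y z)"
    using S_factor_has_prod[of w x y z] by (auto simp: has_prod_def raw_has_prod_def)
  then have "\<forall>\<^sub>F k in sequentially. fps_nth (\<Prod>i\<le>k. S_factor w x y z i) n = S_poly n w x y z"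
    by (simp add: tendsto_fps_iff)
  then obtain K where K: "\<And>k. k \<ge> K \<Longrightarrow> fps_nth (\<Prod>i\<le>k. S_factor w x y z i) n = S_poly n w x y z"
    by (auto simp: eventually_sequentially)
  have "S_poly n w x y z = fps_nth (\<Prod>i<Suc (max K n). S_factor w x y z i) n"
    using K[of "max K n"] by (simp only: lessThan_Suc_atMost)
  also have "\<dots> = fps_nth (\<Prod>j<N. S_factor w x y z j) n"
    using S_factor_prod_nth_stable[of n _ w x y z] assms by (metis less_Suc_eq_le max.cobounded2)
  finally show ?thesis .
qed

lemma fps_nth_compose_X_cubed:
  fixes g :: "'a::idom fps"
  shows "fps_nth (g oo fps_X ^ 3) n = (if 3 dvd n then fps_nth g (n div 3) else 0)"
proof -
  have "fps_nth (g oo fps_X ^ 3) n = (\<Sum>i = 0..n. if i = n div 3 \<and> 3 dvd n then fps_nth g i else 0)"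
    unfolding fps_compose_nth
    by (intro sum.cong) (auto simp: power_mult[symmetric])
  also have "\<dots> = (if 3 dvd n then fps_nth g (n div 3) else 0)"
    by (cases "3 dvd n") (auto simp: sum.delta)
  finally show ?thesis .
qed

lemma S_factor_Suc:
  fixes w x y z :: "'a::idom"
  shows "S_factor w x y z (Suc j) = S_factor w x y z j oo fps_X ^ 3"
  unfolding S_factor_def
  by (simp add: fps_compose_mult_distrib fps_compose_add_distrib fps_compose_power[symmetric]
      fps_X_fps_compose_startby0 power_mult[symmetric] mult_ac)

text \<open>The polynomial factor is \<open>S_factor w x y z 0\<close>, expanded in powers of \<open>q\<close>.\<close>

lemma S_factor_prod_Suc:
  fixes w x y z :: "'a::idom"
  shows "(\<Prod>j<Suc N. S_factor w x y z j) =
    (1 + fps_const (w + x + y) * fps_X + fps_const (w * x + (w + x) * y + z) * fps_X ^ 2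
       + fps_const (w * x * y + (w + x) * z) * fps_X ^ 3 + fps_const (w * x * z) * fps_X ^ 4)
    * ((\<Prod>j<N. S_factor w x y z j) oo fps_X ^ 3)"
proof -
  have "(\<Prod>j<Suc N. S_factor w x y z j)
      = S_factor w x y z 0 * ((\<Prod>j<N. S_factor w x y z j) oo fps_X ^ 3)"
    by (simp add: prod.lessThan_Suc_shift S_factor_Suc fps_compose_prod_distrib del: prod.lessThan_Suc)
  moreover have "S_factor w x y z 0 =
     1 + fps_const (w + x + y) * fps_X + fps_const (w * x + (w + x) * y + z) * fps_X ^ 2
       + fps_const (w * x * y + (w + x) * z) * fps_X ^ 3 + fps_const (w * x * z) * fps_X ^ 4"
    unfolding S_factor_def fps_const_add[symmetric] fps_const_mult[symmetric]
    by (simp add: algebra_simps power_numeral_reduce)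
  ultimately show ?thesis by simp
qed

lemma S_poly_rec:
  fixes w x y z :: "'a::idom"
  shows "S_poly (3 * m + 3) w x y z =
      S_poly (m + 1) w x y z + (w * x * y + (w + x) * z) * S_poly m w x y z"
    and "S_poly (3 * m + 4) w x y z =
      (w + x + y) * S_poly (m + 1) w x y z + w * x * z * S_poly m w x y z"
proof -
  define N where "N = 3 * m + 4"
  define G where "G = (\<Prod>j<N. S_factor w x y z j) oo fps_X ^ 3"
  have G: "fps_nth G k = (if 3 dvd k then S_poly (k div 3) w x y z else 0)" if "k \<le> N" for k
    using that S_poly_eq_finite_prod[of "k div 3" N w x y z]
    by (auto simp: G_def fps_nth_compose_X_cubed N_def)
  have S: "S_poly k w x y z = fps_nth G k
      + (if k = 0 then 0 else (w + x + y) * fps_nth G (k - 1))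
      + (if k < 2 then 0 else (w * x + (w + x) * y + z) * fps_nth G (k - 2))
      + (if k < 3 then 0 else (w * x * y + (w + x) * z) * fps_nth G (k - 3))
      + (if k < 4 then 0 else w * x * z * fps_nth G (k - 4))" if "k \<le> N" for k
    using that unfolding S_poly_eq_finite_prod[OF le_imp_less_Suc[OF that]] S_factor_prod_Suc
    by (simp add: G_def[symmetric] distrib_right mult.assoc fps_X_power_mult_nth
             del: fps_const_add fps_const_mult)
  have no3: "\<not> 3 dvd 3 * m + 1" "\<not> 3 dvd 3 * m + 2" "\<not> 3 dvd 3 * m + 4"
    "0 < m \<longrightarrow> \<not> 3 dvd 3 * m - Suc 0"
    by presburger+
  show "S_poly (3 * m + 3) w x y z =
      S_poly (m + 1) w x y z + (w * x * y + (w + x) * z) * S_poly m w x y z"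
    using S[of "3 * m + 3"] no3 by (simp add: N_def G)
  show "S_poly (3 * m + 4) w x y z =
      (w + x + y) * S_poly (m + 1) w x y z + w * x * z * S_poly m w x y z"
    using S[of "3 * m + 4"] no3 by (simp add: N_def G)
qed

lemma S_poly_0: "S_poly 0 w x y z = 1"
  by (simp add: S_poly_eq_finite_prod[of 0 1] S_factor_def)

lemma S_poly_1: "S_poly 1 w x y z = w + x + y"
proof -
  have "S_poly 1 w x y z = fps_nth (\<Prod>j<2. S_factor w x y z j) 1"
    by (rule S_poly_eq_finite_prod) simp
  also have "(\<Prod>j<2. S_factor w x y z j)
      = S_factor w x y z 0 * S_factor w x y z 1"
    by (simp add: numeral_2_eq_2)
  also have "fps_nth \<dots> 1 = w + x + y"
    by (simp add: S_factor_def fps_mult_nth_1 fps_X_power_iff)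
  finally show ?thesis .
qed

text \<open>Trace and determinant of the matrix with rows \<open>(w x y + (w + x) z, 1)\<close> and
  \<open>(w x z, w + x + y)\<close>, which carries \<open>(S m, S (m + 1))\<close> to \<open>(S (3 m + 3), S (3 m + 4))\<close>.\<close>

definition Q_trace :: "'a::idom \<Rightarrow> 'a \<Rightarrow> 'a \<Rightarrow> 'a \<Rightarrow> 'a" where
  "Q_trace w x y z = (w + x + y) + (w * x * y + (w + x) * z)"

definition Q_det :: "'a::idom \<Rightarrow> 'a \<Rightarrow> 'a \<Rightarrow> 'a \<Rightarrow> 'a" where
  "Q_det w x y z = (w + x + y) * (w * x * y + (w + x) * z) - w * x * z"

lemma Q_poly_1: "Q_poly 1 w x y z = 1"
  by (simp add: Q_poly_def S_poly_0)

text \<open>Write \<open>R n\<close> for the value of \<open>S_poly\<close> at the index following that of \<open>Q_poly n\<close>. The vector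
  \<open>(Q n, R n)\<close> is multiplied by the same matrix at each step; eliminating \<open>R\<close> gives the second-order
  recurrence.\<close>

lemma Q_poly_rec:
  fixes w x y z :: "'a::idom"
  shows "n \<ge> 1 \<Longrightarrow> Q_poly (n + 2) w x y z
      = Q_trace w x y z * Q_poly (n + 1) w x y z - Q_det w x y z * Q_poly n w x y z"
    and "Q_poly 2 w x y z = Q_trace w x y z"
proof -
  define a where "a n = (3 ^ n - 3 :: nat) div 2" for n
  have a_Suc: "a (Suc k) = 3 * a k + 3" if "k \<ge> 1" for k
  proof -
    have "odd (3 ^ k :: nat)" by simp
    moreover have "(3::nat) \<le> 3 ^ k" using that self_le_power[of "3::nat" k] by simp
    ultimately show ?thesis unfolding a_def power_Suc by presburger
  qed
  define R where "R k = S_poly (a k + 1) w x y z" for k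
  have Q: "Q_poly (Suc k) w x y z = R k + (w * x * y + (w + x) * z) * Q_poly k w x y z"
    if "k \<ge> 1" for k
    using S_poly_rec(1)[of "a k"] a_Suc[OF that] by (simp add: Q_poly_def R_def a_def)
  have R: "R (Suc k) = (w + x + y) * R k + w * x * z * Q_poly k w x y z" if "k \<ge> 1" for k
  proof -
    have next_index: "a (Suc k) + 1 = 3 * a k + 4" using a_Suc[OF that] by simp
    show ?thesis
      unfolding R_def next_index using S_poly_rec(2)[of "a k"] by (simp add: Q_poly_def a_def)
  qed
  show "Q_poly (n + 2) w x y z
      = Q_trace w x y z * Q_poly (n + 1) w x y z - Q_det w x y z * Q_poly n w x y z"
    if n: "n \<ge> 1"
  proof -
    have R_elim: "R n = Q_poly (Suc n) w x y z - (w * x * y + (w + x) * z) * Q_poly n w x y z"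
      using Q[OF n] by simp
    have "Q_poly (n + 2) w x y z = (w + x + y) * R n + w * x * z * Q_poly n w x y z
        + (w * x * y + (w + x) * z) * Q_poly (Suc n) w x y z"
      using Q[of "Suc n"] R[OF n] by simp
    then show ?thesis
      unfolding R_elim by (simp add: Q_trace_def Q_det_def algebra_simps)
  qed
  have "R 1 = w + x + y" using S_poly_1[of w x y z] by (simp add: R_def a_def)
  then show "Q_poly 2 w x y z = Q_trace w x y z"
    using Q[of 1] Q_poly_1[of w x y z] by (simp add: Q_trace_def numeral_2_eq_2)
qed

section \<open>Zeros of Lucas sequences\<close>

lemma exists_sum_product_complex:
  fixes t d :: complex
  obtains \<alpha> \<beta> where "\<alpha> + \<beta> = t" "\<alpha> * \<beta> = d"
proof
  show "(t + csqrt (t^2 - 4 * d)) / 2 + (t - csqrt (t^2 - 4 * d)) / 2 = t"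
    by (simp add: field_simps)
  have "(t + csqrt (t^2 - 4 * d)) * (t - csqrt (t^2 - 4 * d)) = t^2 - (csqrt (t^2 - 4 * d))^2"
    by (simp add: algebra_simps power2_eq_square)
  then show "(t + csqrt (t^2 - 4 * d)) / 2 * ((t - csqrt (t^2 - 4 * d)) / 2) = d"
    by simp
qed

text \<open>If \<open>u n = 0\<close> and not \<open>t = d = 0\<close>, the characteristic roots have a quotient
  \<open>\<omega> \<noteq> 1\<close> on the unit circle, and
  \<open>t^2 / d = (\<alpha> + \<beta>)^2 / (\<alpha> * \<beta>) = \<omega> + 2 + 1 / \<omega> = 2 + 2 * Re \<omega>\<close>. The starting values stand
  at the indices \<open>1\<close> and \<open>2\<close>. If \<open>t = d = 0\<close>, the sequence degenerates to \<open>1, 0, 0, \<dots>\<close>,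
  and the equation \<open>t^2 = 4 s d\<close> holds trivially.\<close>

lemma Lucas_sequence_zero_imp:
  fixes u :: "nat \<Rightarrow> complex"
  assumes u1: "u 1 = 1" and u2: "u 2 = t"
    and rec: "\<And>n. n \<ge> 1 \<Longrightarrow> u (n + 2) = t * u (n + 1) - d * u n"
    and n: "n \<ge> 1" and zero: "u n = 0"
  obtains s :: real where "0 \<le> s" "s < 1" "t^2 = 4 * of_real s * d"
proof (cases "t = 0 \<and> d = 0")
  case True
  then show ?thesis using that[of 0] by simp
next
  case False
  obtain \<alpha> \<beta> where t: "\<alpha> + \<beta> = t" and d: "\<alpha> * \<beta> = d"
    using exists_sum_product_complex .
  have geo: "u (Suc k) = (\<Sum>i<Suc k. \<alpha>^i * \<beta>^(k - i)) \<and>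
        u (Suc (Suc k)) = (\<Sum>i<Suc (Suc k). \<alpha>^i * \<beta>^(Suc k - i))" for k
  proof (induction k)
    case 0
    then show ?case using u1 u2 t by (simp add: numeral_2_eq_2 add.commute)
  next
    case (Suc k)
    have step: "(\<Sum>i<Suc j. \<alpha>^i * \<beta>^(j - i)) = \<beta> * (\<Sum>i<j. \<alpha>^i * \<beta>^(j - 1 - i)) + \<alpha>^j" for j
    proof -
      have "(\<Sum>i<j. \<alpha>^i * \<beta>^(j - i)) = (\<Sum>i<j. \<beta> * (\<alpha>^i * \<beta>^(j - 1 - i)))"
      proof (intro sum.cong refl)
        fix i assume "i \<in> {..<j}"
        then have "j - i = Suc (j - 1 - i)" by auto
        then show "\<alpha>^i * \<beta>^(j - i) = \<beta> * (\<alpha>^i * \<beta>^(j - 1 - i))" by simp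
      qed
      then show ?thesis by (simp add: sum_distrib_left)
    qed
    have "u (Suc (Suc (Suc k))) = t * u (Suc (Suc k)) - d * u (Suc k)"
      using rec[of "Suc k"] by simp
    also have "\<dots> = \<beta> * u (Suc (Suc k)) + \<alpha> * (u (Suc (Suc k)) - \<beta> * u (Suc k))"
      by (simp add: t[symmetric] d[symmetric] algebra_simps)
    also have "u (Suc (Suc k)) - \<beta> * u (Suc k) = \<alpha> ^ Suc k"
      using Suc.IH step[of "Suc k"] by simp
    also have "\<beta> * u (Suc (Suc k)) + \<alpha> * \<alpha> ^ Suc k
        = (\<Sum>i<Suc (Suc (Suc k)). \<alpha>^i * \<beta>^(Suc (Suc k) - i))"
      using Suc.IH step[of "Suc (Suc k)"] by simp
    finally show ?case using Suc.IH by blast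
  qed
  obtain k where k: "n = Suc k" using n by (cases n) auto
  have sum0: "(\<Sum>i<Suc k. \<alpha>^i * \<beta>^(k - i)) = 0" using geo zero k by simp
  have eq: "\<alpha>^n = \<beta>^n"
  proof -
    have "\<alpha> ^ Suc k - \<beta> ^ Suc k = (\<alpha> - \<beta>) * (\<Sum>i<Suc k. \<alpha>^i * \<beta>^(k - i))"
      using diff_power_eq_sum[of \<alpha> k \<beta>] by simp
    then show ?thesis using sum0 k by simp
  qed
  have ne: "\<alpha> \<noteq> \<beta>"
  proof
    assume "\<alpha> = \<beta>"
    then have "(\<Sum>i<Suc k. \<alpha>^i * \<beta>^(k - i)) = (\<Sum>i<Suc k. \<beta>^k)"
      by (intro sum.cong) (auto simp: power_add[symmetric])
    then have "of_nat (Suc k) * \<beta>^k = 0" using sum0 by (simp del: of_nat_Suc)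
    then have "\<beta> = 0" by (simp del: of_nat_Suc)
    then show False using \<open>\<alpha> = \<beta>\<close> t d False by auto
  qed
  have nz: "\<beta> \<noteq> 0" using eq ne n by (metis power_eq_0_iff zero_power less_le_trans zero_less_one)
  define \<omega> where "\<omega> = \<alpha> / \<beta>"
  have "\<omega> ^ n = 1" using eq nz by (simp add: \<omega>_def power_divide)
  then have norm1: "norm \<omega> = 1"
    using n by (metis norm_power norm_one norm_ge_zero power_eq_1_iff not_one_le_zero)
  have ne1: "\<omega> \<noteq> 1" using ne nz by (simp add: \<omega>_def)
  have sq1: "(Re \<omega>)^2 + (Im \<omega>)^2 = 1" using norm1 cmod_power2[of \<omega>] by simp
  have "\<bar>Re \<omega>\<bar> \<le> 1" using abs_Re_le_cmod[of \<omega>] norm1 by simp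
  moreover have "Re \<omega> \<noteq> 1" using sq1 ne1 by (auto simp: complex_eq_iff)
  ultimately have bounds: "- 1 \<le> Re \<omega>" "Re \<omega> < 1" by auto
  have "(\<omega> + 1)^2 = of_real (2 + 2 * Re \<omega>) * \<omega>"
    using sq1 by (simp add: complex_eq_iff power2_eq_square algebra_simps)
  moreover have "\<alpha> = \<omega> * \<beta>" using nz by (simp add: \<omega>_def)
  ultimately have "t^2 = of_real (2 + 2 * Re \<omega>) * d"
    unfolding t[symmetric] d[symmetric] by algebra
  then have "t^2 = 4 * of_real ((1 + Re \<omega>) / 2) * d" by simp
  with bounds show ?thesis by (intro that[of "(1 + Re \<omega>) / 2"]) auto
qed

section \<open>Location of the zeros\<close>

text \<open>The equation is \<open>t^2 = 4 s d\<close> for the trace and determinant at \<open>(1, 1, z, z)\<close>, divided by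
  \<open>4\<close>. Rewritten as \<open>(4 - 3 s) z^2 + (4 - 5 s) z + 1 = 0\<close>, it is a real quadratic with discriminant
  \<open>s (25 s - 28) \<le> 0\<close>, so its roots are conjugate or coincide, and half their sum and
  their product are \<open>Re z\<close> and \<open>\<bar>z\<bar>^2\<close>.\<close>

lemma zeros_on_circle:
  fixes z :: complex and s :: real
  assumes s: "0 \<le> s" "s < 1" and eq: "(2 * z + 1)^2 = of_real s * (3 * z^2 + 5 * z)"
  shows "z \<in> sphere (3/8) (7/8) \<and> Re z < 1/2"
proof -
  define a where "a = Re z"
  define b where "b = Im z"
  have re: "(4 - 3 * s) * (a^2 - b^2) + (4 - 5 * s) * a + 1 = 0"
    using arg_cong[OF eq, of Re] by (simp add: a_def b_def power2_eq_square algebra_simps)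
  have im: "b * (2 * (4 - 3 * s) * a + (4 - 5 * s)) = 0"
    using arg_cong[OF eq, of Im] by (simp add: a_def b_def power2_eq_square algebra_simps)
  have half_sum: "2 * (4 - 3 * s) * a + (4 - 5 * s) = 0"
  proof (cases "b = 0")
    case True
    \<comment> \<open>Completing the square: a real root forces the discriminant to vanish.\<close>
    have "(2 * (4 - 3 * s) * a + (4 - 5 * s))^2 = s * (25 * s - 28)"
      using re True by (simp, algebra)
    also have "\<dots> \<le> 0" using s by (intro mult_nonneg_nonpos) auto
    finally show ?thesis by simp
  qed (use im in simp)
  have prod: "(4 - 3 * s) * (a^2 + b^2) = 1"
    using re half_sum by algebra
  have pos: "4 - 3 * s > 0" using s by simp
  have "(4 - 3 * s) * (64 * ((a - 3/8)^2 + b^2)) = (4 - 3 * s) * 49"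
    using prod half_sum by (simp add: power2_eq_square algebra_simps)
  then have "(a - 3/8)^2 + b^2 = (7/8)^2"
    using pos by (simp only: mult_cancel_left) (simp add: power2_eq_square)
  then have "norm (z - 3/8) = 7/8"
    by (simp add: cmod_def a_def b_def real_sqrt_unique)
  moreover have "a < 1/2"
  proof -
    have "(4 - 3 * s) * (2 * a) < (4 - 3 * s) * 1" using half_sum s by (simp add: algebra_simps)
    then show ?thesis using pos by (simp only: mult_less_cancel_left_pos)
  qed
  ultimately show ?thesis by (simp add: a_def dist_norm norm_minus_commute)
qed

theorem proposition5p6:
  fixes n :: nat
  assumes "n \<ge> 2"
  shows "\<forall>z::complex. poly (Q3_poly n) z = 0 \<longrightarrow> z \<in> sphere (3/8) (7/8) \<and> Re z < 1/2"
proof (intro allI impI)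
  fix z :: complex
  assume zero: "poly (Q3_poly n) z = 0"
  define t where "t = 4 * z + 2"
  define d where "d = 3 * z^2 + 5 * z"
  have t: "poly (Q_trace 1 1 [:0, 1:] [:0, 1:]) z = t"
    by (simp add: Q_trace_def t_def)
  have d: "poly (Q_det 1 1 [:0, 1:] [:0, 1:]) z = d"
    by (simp add: Q_det_def d_def algebra_simps power2_eq_square)
  obtain s :: real where s: "0 \<le> s" "s < 1" and td: "t^2 = 4 * of_real s * d"
  proof (rule Lucas_sequence_zero_imp[of "\<lambda>k. poly (Q3_poly k) z" t d n])
    show "poly (Q3_poly 1) z = 1" by (simp only: Q3_poly_def Q_poly_1 poly_1)
    show "poly (Q3_poly 2) z = t" by (simp only: Q3_poly_def Q_poly_rec(2) t)
    show "poly (Q3_poly (k + 2)) z = t * poly (Q3_poly (k + 1)) z - d * poly (Q3_poly k) z"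
      if "k \<ge> 1" for k
      by (simp only: Q3_poly_def Q_poly_rec(1)[OF that] poly_diff poly_mult t d)
  qed (use assms zero in auto)
  have "(2 * z + 1)^2 = of_real s * (3 * z^2 + 5 * z)"
  proof -
    have "4 * (2 * z + 1)^2 = t^2" by (simp add: t_def power2_eq_square algebra_simps)
    then show ?thesis using td by (simp add: d_def)
  qed
  then show "z \<in> sphere (3/8) (7/8) \<and> Re z < 1/2"
    using zeros_on_circle s by blast
qed

end
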